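(* Let $\Delta>k\geq 2$ be integers, and let $$\beta:=\left((k-1)\Delta\binom{\Delta-1}{k}\right)^{1/k}\quad\text{and}\quad c:=\Delta+\left\lceil\frac{k\beta}{k-1}\right\rceil.$$ Then every graph $G$ with maximum degree $\Delta$ has a $k$-frugal $c$-colouring. Moreover, for every $c$-list-assignment $L$ of $G$, the number of $k$-frugal $L$-colourings of $G$ is at least $\beta^{|V(G)|}$.
   Context: Graphs are finite and simple; $N_G(v)$ denotes the set of neighbours of $v$. For an integer $k\geq 1$, a colouring $\phi$ of $G$ is $k$-frugal if it is proper and for every vertex $v$ and every colour $i$, at most $k$ vertices $w\in N_G(v)$ have $\phi(w)=i$. A $c$-colouring uses at most $c$ colours. A list-assignment $L$ assigns each vertex $v$ a set $L(v)$ of colours; it is a $c$-list-assignment if $|L(v)|=c$ for all $v$; an $L$-colouring is a colouring $\phi$ with $\phi(v)\in L(v)$ for all $v$. *)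

theory Defs
  imports Complex_Main "HOL-Library.FuncSet" "Graph_Theory.Pair_Digraph"
begin

text \<open>
  A finite simple graph is a \<^locale>\<open>pair_graph\<close>: a finite, loop-free, symmetric digraph whose arcs
  are ordered pairs of vertices, so that each edge \<open>uv\<close> is represented by the two arcs \<open>(u,v)\<close>
  and \<open>(v,u)\<close>.
\<close>

definition neighbours :: "'a pair_pre_digraph \<Rightarrow> 'a \<Rightarrow> 'a set" where
  "neighbours G v = {w. (v, w) \<in> parcs G}"

text \<open>The inserted \<open>0\<close> only matters for the graph without vertices.\<close>

definition max_degree :: "'a pair_pre_digraph \<Rightarrow> nat" where
  "max_degree G = Max (insert 0 ((\<lambda>v. card (neighbours G v)) ` pverts G))"

definition proper_colouring :: "'a pair_pre_digraph \<Rightarrow> ('a \<Rightarrow> 'c) \<Rightarrow> bool" where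
  "proper_colouring G \<phi> \<longleftrightarrow> (\<forall>(u, v) \<in> parcs G. \<phi> u \<noteq> \<phi> v)"

definition frugal :: "nat \<Rightarrow> 'a pair_pre_digraph \<Rightarrow> ('a \<Rightarrow> 'c) \<Rightarrow> bool" where
  "frugal k G \<phi> \<longleftrightarrow> proper_colouring G \<phi> \<and>
     (\<forall>v \<in> pverts G. \<forall>i. card {w \<in> neighbours G v. \<phi> w = i} \<le> k)"

definition uses_at_most :: "nat \<Rightarrow> 'a pair_pre_digraph \<Rightarrow> ('a \<Rightarrow> 'c) \<Rightarrow> bool" where
  "uses_at_most c G \<phi> \<longleftrightarrow> card (\<phi> ` pverts G) \<le> c"

definition list_assignment :: "nat \<Rightarrow> 'a pair_pre_digraph \<Rightarrow> ('a \<Rightarrow> 'c set) \<Rightarrow> bool" where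
  "list_assignment c G L \<longleftrightarrow> (\<forall>v \<in> pverts G. finite (L v) \<and> card (L v) = c)"

text \<open>
  The functions in \<^term>\<open>Pi\<^sub>E\<close> are \<^term>\<open>undefined\<close> off the vertex set, so colourings that agree on
  all vertices are counted once.
\<close>

definition list_colourings :: "'a pair_pre_digraph \<Rightarrow> ('a \<Rightarrow> 'c set) \<Rightarrow> ('a \<Rightarrow> 'c) set" where
  "list_colourings G L = (\<Pi>\<^sub>E v \<in> pverts G. L v)"

definition frugal_list_colourings ::
    "nat \<Rightarrow> 'a pair_pre_digraph \<Rightarrow> ('a \<Rightarrow> 'c set) \<Rightarrow> ('a \<Rightarrow> 'c) set" where
  "frugal_list_colourings k G L = {\<phi> \<in> list_colourings G L. frugal k G \<phi>}"

end

theory Submission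
  imports Defs
begin

text \<open>
  The proof is Rosenfeld's counting argument. For a set \<open>S\<close> of vertices let \<open>P S\<close> be the number of
  partial \<open>k\<close>-frugal list colourings of \<open>S\<close>. One shows \<open>\<beta> * P (S - {v}) \<le> P S\<close> by strong induction
  on \<open>S\<close>. Every colouring of \<open>S - {v}\<close> has at least \<open>c - \<Delta>\<close> proper extensions to \<open>v\<close>. If an
  extension is not frugal, then \<open>v\<close> and some \<open>k\<close>-set \<open>T\<close> are monochromatic in the neighbourhood of
  some neighbour of \<open>v\<close>; there are at most \<open>\<Delta> * ((\<Delta> - 1) choose k)\<close> such \<open>T\<close>, and for each of them
  the extension is determined by its restriction to \<open>S - {v}\<close> without all but one vertex of \<open>T\<close>,
  so by induction at most \<open>P (S - {v}) / \<beta> ^ (k - 1)\<close> extensions are bad for \<open>T\<close>.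
\<close>

text \<open>
  Frugality is imposed around all vertices of \<open>G\<close>, not only around those of \<open>S\<close>: a partial
  colouring is thus constrained also by neighbourhoods of uncoloured vertices.
\<close>

definition partial_frugal_colourings ::
    "nat \<Rightarrow> 'a pair_pre_digraph \<Rightarrow> ('a \<Rightarrow> 'c set) \<Rightarrow> 'a set \<Rightarrow> ('a \<Rightarrow> 'c) set" where
  "partial_frugal_colourings k G L S = {\<phi> \<in> Pi\<^sub>E S L.
     (\<forall>(u, w) \<in> parcs G. u \<in> S \<longrightarrow> w \<in> S \<longrightarrow> \<phi> u \<noteq> \<phi> w) \<and>
     (\<forall>v \<in> pverts G. \<forall>i. card {w \<in> neighbours G v \<inter> S. \<phi> w = i} \<le> k)}"

section \<open>Neighbourhoods in a finite simple graph\<close>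

lemma neighbours_subset:
  assumes "pair_graph G"
  shows "neighbours G v \<subseteq> pverts G"
proof -
  interpret pair_graph G by fact
  show ?thesis unfolding neighbours_def using in_arcsD2 by auto
qed

lemma finite_neighbours:
  assumes "pair_graph G"
  shows "finite (neighbours G v)"
proof -
  interpret pair_graph G by fact
  show ?thesis using neighbours_subset[OF assms] by (rule finite_subset) simp
qed

lemma neighbours_sym:
  assumes "pair_graph G"
  shows "u \<in> neighbours G v \<longleftrightarrow> v \<in> neighbours G u"
proof -
  interpret pair_graph G by fact
  show ?thesis unfolding neighbours_def using arcs_symmetric by blast
qed

lemma not_self_neighbour:
  assumes "pair_graph G"
  shows "v \<notin> neighbours G v"
proof -
  interpret pair_graph G by fact
  show ?thesis unfolding neighbours_def using no_loops' by blast
qed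

lemma card_neighbours_le_max_degree:
  assumes "pair_graph G" and "v \<in> pverts G"
  shows "card (neighbours G v) \<le> max_degree G"
proof -
  interpret pair_graph G by fact
  show ?thesis unfolding max_degree_def using assms(2) by (intro Max_ge) auto
qed

section \<open>Partial colourings on varying vertex sets\<close>

lemma finite_partial_frugal_colourings:
  assumes "finite S" and "\<And>v. v \<in> S \<Longrightarrow> finite (L v)"
  shows "finite (partial_frugal_colourings k G L S)"
  using finite_PiE[of S L] assms
  by (auto simp: partial_frugal_colourings_def intro: finite_subset[of _ "Pi\<^sub>E S L"])

lemma restrict_partial_frugal_colouring:
  assumes "pair_graph G" and "\<phi> \<in> partial_frugal_colourings k G L S" and "T \<subseteq> S"
  shows "restrict \<phi> T \<in> partial_frugal_colourings k G L T"
proof -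
  have "card {w \<in> neighbours G v \<inter> T. restrict \<phi> T w = i} \<le> k" if "v \<in> pverts G" for v i
  proof -
    have "card {w \<in> neighbours G v \<inter> T. restrict \<phi> T w = i}
        \<le> card {w \<in> neighbours G v \<inter> S. \<phi> w = i}"
      using assms(3) finite_neighbours[OF assms(1), of v] by (intro card_mono) auto
    also have "\<dots> \<le> k" using assms(2) that by (simp add: partial_frugal_colourings_def)
    finally show ?thesis .
  qed
  then show ?thesis
    using assms(2,3) unfolding partial_frugal_colourings_def
    by (fastforce simp: PiE_iff)
qed

lemma partial_frugal_colourings_pverts:
  assumes "pair_graph G"
  shows "partial_frugal_colourings k G L (pverts G) = frugal_list_colourings k G L"
proof -
  interpret pair_graph G by fact
  have "neighbours G v \<inter> pverts G = neighbours G v" for v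
    using neighbours_subset[OF assms] by blast
  then show ?thesis
    unfolding partial_frugal_colourings_def frugal_list_colourings_def frugal_def
      proper_colouring_def list_colourings_def
    using in_arcsD1 in_arcsD2 by fastforce
qed

text \<open>Iterates \<open>step\<close>, deleting the vertices of \<open>A\<close> one at a time.
  It serves twice: inside the induction to forget all but one vertex of a monochromatic set, and at
  the end to empty the whole graph.\<close>

lemma card_partial_frugal_colourings_diff:
  fixes \<beta> :: real
  assumes "finite A" and "A \<subseteq> S" and "0 \<le> \<beta>"
    and step: "\<And>S' v. S' \<subseteq> S \<Longrightarrow> v \<in> S' \<Longrightarrow>
      \<beta> * card (partial_frugal_colourings k G L (S' - {v}))
        \<le> card (partial_frugal_colourings k G L S')"
  shows "\<beta> ^ card A * card (partial_frugal_colourings k G L (S - A))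
    \<le> card (partial_frugal_colourings k G L S)"
  using assms(1,2)
proof (induction A rule: finite_induct)
  case empty
  then show ?case by simp
next
  case (insert x A)
  let ?P = "\<lambda>S. real (card (partial_frugal_colourings k G L S))"
  have "S - insert x A = (S - A) - {x}" by auto
  then have "\<beta> ^ card (insert x A) * ?P (S - insert x A) = \<beta> ^ card A * (\<beta> * ?P ((S - A) - {x}))"
    using insert.hyps by simp
  also have "\<dots> \<le> \<beta> ^ card A * ?P (S - A)"
    using step[of "S - A" x] insert assms(3) by (intro mult_left_mono) auto
  also have "\<dots> \<le> ?P S" using insert by simp
  finally show ?case .
qed

section \<open>Extending partial colourings by one vertex\<close>

text \<open>
  A colouring of \<open>R\<close> extended by \<open>v\<close>, with \<open>T\<close> and \<open>v\<close> monochromatic, can be recovered after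
  forgetting \<open>v\<close> and all vertices of \<open>T\<close> but one.
\<close>

lemma card_monochromatic_extensions_le:
  assumes G: "pair_graph G" and fin: "finite R" "\<And>w. w \<in> R \<Longrightarrow> finite (L w)"
    and T: "t \<in> T" "T \<subseteq> R"
    and B: "B \<subseteq> {\<psi> \<in> extensional (insert v R).
      restrict \<psi> R \<in> partial_frugal_colourings k G L R \<and> (\<forall>w\<in>T. \<psi> w = \<psi> v)}"
  shows "card B \<le> card (partial_frugal_colourings k G L (R - (T - {t})))"
    (is "_ \<le> card (partial_frugal_colourings k G L ?Q)")
proof (rule card_inj_on_le)
  show "inj_on (\<lambda>\<psi>. restrict \<psi> ?Q) B"
  proof (rule inj_onI)
    fix \<psi> \<chi> assume "\<psi> \<in> B" and "\<chi> \<in> B" and eq: "restrict \<psi> ?Q = restrict \<chi> ?Q"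
    note \<psi> = subsetD[OF B \<open>\<psi> \<in> B\<close>] and \<chi> = subsetD[OF B \<open>\<chi> \<in> B\<close>]
    have Q: "\<psi> w = \<chi> w" if "w \<in> ?Q" for w
      using fun_cong[OF eq, of w] that by auto
    have "\<psi> t = \<chi> t" using T by (intro Q) auto
    moreover have "\<psi> w = \<psi> t" "\<chi> w = \<chi> t" if "w \<in> insert v T" for w
      using \<psi> \<chi> that T by auto
    ultimately have "\<psi> w = \<chi> w" if "w \<in> insert v R" for w
      using that Q[of w] by (cases "w \<in> insert v T") auto
    then show "\<psi> = \<chi>" using \<psi> \<chi> by (intro extensionalityI[of _ "insert v R"]) auto
  qed
  show "(\<lambda>\<psi>. restrict \<psi> ?Q) ` B \<subseteq> partial_frugal_colourings k G L ?Q"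
  proof safe
    fix \<psi> assume "\<psi> \<in> B"
    with B have "restrict \<psi> R \<in> partial_frugal_colourings k G L R" by blast
    from restrict_partial_frugal_colouring[OF G this, of ?Q]
    show "restrict \<psi> ?Q \<in> partial_frugal_colourings k G L ?Q"
      by (simp add: Int_absorb1)
  qed
  show "finite (partial_frugal_colourings k G L ?Q)"
    using fin by (intro finite_partial_frugal_colourings) auto
qed

text \<open>Colouring \<open>v\<close> enlarges only colour classes that contain \<open>v\<close>.
  If some \<open>u\<close> sees more than \<open>k\<close> vertices of one colour, then
  \<open>v\<close> must be among them, since \<phi> itself is frugal. So \<open>u\<close> is a
  neighbour of \<open>v\<close>, the colour is \<open>a\<close>, and at least \<open>k\<close> other
  vertices of that class remain from which to choose \<open>T\<close>.\<close>

lemma proper_extension_cases: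
  assumes G: "pair_graph G" and v: "v \<notin> R"
    and \<phi>: "\<phi> \<in> partial_frugal_colourings k G L R"
    and a: "a \<in> L v - \<phi> ` (neighbours G v \<inter> R)"
  obtains "\<phi>(v := a) \<in> partial_frugal_colourings k G L (insert v R)"
  | u T where "u \<in> neighbours G v" "T \<subseteq> (neighbours G u - {v}) \<inter> R" "card T = k"
      "\<forall>w\<in>T. \<phi> w = a"
proof (cases "\<phi>(v := a) \<in> partial_frugal_colourings k G L (insert v R)")
  case False
  let ?\<psi> = "\<phi>(v := a)" and ?S = "insert v R"
  have "?\<psi> \<in> Pi\<^sub>E ?S L"
    using \<phi> a v by (auto simp: partial_frugal_colourings_def PiE_iff extensional_def)
  \<comment> \<open>Only edges at \<open>v\<close> are new, and \<open>a\<close> avoids all colours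
    on the coloured neighbours of \<open>v\<close>.\<close>
  moreover have "?\<psi> x \<noteq> ?\<psi> w" if "(x, w) \<in> parcs G" "x \<in> ?S" "w \<in> ?S" for x w
  proof -
    have "w \<in> neighbours G x" using that by (simp add: neighbours_def)
    moreover from this have "x \<in> neighbours G w" "x \<noteq> w"
      using neighbours_sym[OF G] not_self_neighbour[OF G] by blast+
    moreover have "\<phi> x \<noteq> \<phi> w" if "x \<in> R" "w \<in> R"
      using \<phi> that \<open>(x, w) \<in> parcs G\<close> by (auto simp: partial_frugal_colourings_def)
    ultimately show ?thesis using that a by auto
  qed
  ultimately have "\<not> (\<forall>u\<in>pverts G. \<forall>i. card {w \<in> neighbours G u \<inter> ?S. ?\<psi> w = i} \<le> k)"
    using False unfolding partial_frugal_colourings_def by blast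
  then obtain u i where u: "u \<in> pverts G"
      and many: "k < card {w \<in> neighbours G u \<inter> ?S. ?\<psi> w = i}" (is "k < card ?M")
    by (meson not_le)
  let ?M' = "{w \<in> neighbours G u \<inter> R. \<phi> w = i}"
  have few: "card ?M' \<le> k" using \<phi> u by (simp add: partial_frugal_colourings_def)
  have M': "?M - {v} = ?M'" using v by auto
  have "v \<in> ?M"
  proof (rule ccontr)
    assume "v \<notin> ?M"
    then have "?M = ?M'" using M' by blast
    then show False using many few by (metis leD)
  qed
  then have "v \<in> neighbours G u" and i: "i = a" by auto
  then have uv: "u \<in> neighbours G v" using neighbours_sym[OF G] by blast
  have "card (?M - {v}) = card ?M - 1" using \<open>v \<in> ?M\<close> by (rule card_Diff_singleton)
  then have "k \<le> card (?M - {v})" using many by linarith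
  then obtain T where "T \<subseteq> ?M'" "card T = k"
    unfolding M' by (rule obtain_subset_with_card_n)
  then show ?thesis using that(2)[OF uv, of T] v i by blast
qed (use that in blast)

text \<open>Compares a lower bound on the number of proper extensions with a union bound: each is
  frugal or bad for some \<open>T\<close>. The inequality is multiplied by
  \<open>\<beta> ^ (k - 1)\<close>, which avoids division by \<beta>.\<close>

lemma card_partial_frugal_colourings_insert:
  fixes \<beta> :: real
  assumes G: "pair_graph G" and L: "list_assignment c G L"
    and k: "1 \<le> k" and \<beta>: "0 \<le> \<beta>"
    and vR: "insert v R \<subseteq> pverts G" "v \<notin> R"
    and IH: "\<And>S w. S \<subseteq> R \<Longrightarrow> w \<in> S \<Longrightarrow>
      \<beta> * card (partial_frugal_colourings k G L (S - {w}))
        \<le> card (partial_frugal_colourings k G L S)"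
  defines "\<Delta> \<equiv> max_degree G"
  shows "\<beta> ^ (k - 1) * real (c - \<Delta>) * card (partial_frugal_colourings k G L R)
    \<le> \<beta> ^ (k - 1) * card (partial_frugal_colourings k G L (insert v R))
      + real (\<Delta> * ((\<Delta> - 1) choose k)) * card (partial_frugal_colourings k G L R)"
proof -
  let ?P = "partial_frugal_colourings k G L" and ?S = "insert v R" and ?N = "neighbours G"
  interpret pair_graph G by fact
  have finV: "finite (pverts G)" by simp
  have fin: "finite R" "\<And>w. w \<in> ?S \<Longrightarrow> finite (L w)" and cL: "card (L v) = c"
    using vR L finite_subset[OF _ finV] by (auto simp: list_assignment_def)
  have finP: "finite (?P R)" "finite (?P ?S)"
    using fin by (auto intro!: finite_partial_frugal_colourings)
  have deg: "card (?N w) \<le> \<Delta>" if "w \<in> pverts G" for w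
    unfolding \<Delta>_def using card_neighbours_le_max_degree[OF G that] .
  \<comment> \<open>\<open>Y\<close> holds the extensions that are proper at \<open>v\<close> but
    perhaps not frugal, and \<open>X\<close> parametrises them. \<open>\<T> u\<close> lists the
    candidate sets around \<open>u\<close>, and \<open>B T\<close> the extensions that are bad for
    \<open>T\<close>; intersecting with \<open>Y\<close> makes its finiteness immediate.\<close>
  define X where "X = Sigma (?P R) (\<lambda>\<phi>. L v - \<phi> ` (?N v \<inter> R))"
  define Y where "Y = (\<lambda>(\<phi>, a). \<phi>(v := a)) ` X"
  define \<T> where "\<T> u = {T. T \<subseteq> (?N u - {v}) \<inter> R \<and> card T = k}" for u
  define B where "B T = {\<psi> \<in> extensional ?S. restrict \<psi> R \<in> ?P R \<and> (\<forall>w\<in>T. \<psi> w = \<psi> v)} \<inter> Y" for T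

  \<comment> \<open>Members of \<open>?P R\<close> are \<open>undefined\<close> outside
    \<open>R\<close>, so restriction undoes the update at \<open>v\<close>. This makes the
    parametrisation of \<open>Y\<close> injective.\<close>
  have restr: "restrict (\<phi>(v := a)) R = \<phi>" "\<phi>(v := a) \<in> extensional ?S" if "\<phi> \<in> ?P R" for \<phi> a
    using that vR(2)
    by (auto simp: partial_frugal_colourings_def PiE_iff extensional_def fun_eq_iff restrict_def)
  have finX: "finite X" unfolding X_def using finP fin(2) by auto
  then have finY: "finite Y" unfolding Y_def by simp
  have "inj_on (\<lambda>(\<phi>, a). \<phi>(v := a)) X"
  proof (rule inj_onI, clarify)
    fix \<phi> a \<phi>' a' assume *: "(\<phi>, a) \<in> X" "(\<phi>', a') \<in> X" "\<phi>(v := a) = \<phi>'(v := a')"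
    have "\<phi> = \<phi>'" using restr(1)[of \<phi> a] restr(1)[of \<phi>' a'] * by (simp add: X_def)
    then show "\<phi> = \<phi>' \<and> a = a'" using fun_cong[OF *(3), of v] by simp
  qed
  then have "card Y = card X" unfolding Y_def by (rule card_image)
  also have "\<dots> = (\<Sum>\<phi>\<in>?P R. card (L v - \<phi> ` (?N v \<inter> R)))"
    unfolding X_def using finP fin(2) by (intro card_SigmaI) auto
  also have "\<dots> \<ge> (\<Sum>\<phi>\<in>?P R. c - \<Delta>)"
  proof (rule sum_mono)
    fix \<phi> assume "\<phi> \<in> ?P R"
    have "card (\<phi> ` (?N v \<inter> R)) \<le> card (?N v \<inter> R)"
      using fin by (intro card_image_le) auto
    also have "\<dots> \<le> card (?N v)" using finite_neighbours[OF G] by (intro card_mono) auto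
    also have "\<dots> \<le> \<Delta>" using vR by (intro deg) auto
    finally show "c - \<Delta> \<le> card (L v - \<phi> ` (?N v \<inter> R))"
      using diff_card_le_card_Diff[of "\<phi> ` (?N v \<inter> R)" "L v"] fin(1) cL by auto
  qed
  finally have cardY: "card (?P R) * (c - \<Delta>) \<le> card Y" by simp

  have cover: "Y \<subseteq> ?P ?S \<union> (\<Union>u\<in>?N v. \<Union>T\<in>\<T> u. B T)"
  proof
    fix \<psi> assume \<psi>: "\<psi> \<in> Y"
    then obtain \<phi> a where \<phi>: "\<phi> \<in> ?P R" and a: "a \<in> L v - \<phi> ` (?N v \<inter> R)"
      and eq: "\<psi> = \<phi>(v := a)" by (auto simp: X_def Y_def)
    show "\<psi> \<in> ?P ?S \<union> (\<Union>u\<in>?N v. \<Union>T\<in>\<T> u. B T)"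
    proof (rule proper_extension_cases[OF G vR(2) \<phi> a])
      assume "\<phi>(v := a) \<in> ?P ?S"
      then show ?thesis using eq by simp
    next
      fix u T assume u: "u \<in> ?N v" and T: "T \<subseteq> (?N u - {v}) \<inter> R" "card T = k" "\<forall>w\<in>T. \<phi> w = a"
      have "\<psi> \<in> B T" using \<psi> T(1,3) restr[OF \<phi>, of a] \<phi> unfolding B_def eq by auto
      moreover have "T \<in> \<T> u" using T by (simp add: \<T>_def)
      ultimately show ?thesis using u by blast
    qed
  qed
  have fin\<T>: "finite (\<T> u)" for u unfolding \<T>_def using fin(1) by auto
  \<comment> \<open>The \<open>- 1\<close> comes from \<open>v\<close>, which is a neighbour of
    \<open>u\<close> but is excluded from \<open>T\<close>.\<close>
  have card\<T>: "card (\<T> u) \<le> (\<Delta> - 1) choose k" if "u \<in> ?N v" for u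
  proof -
    have "card (?N u - {v}) = card (?N u) - 1"
      using that neighbours_sym[OF G] by (intro card_Diff_singleton) blast
    moreover have "card (?N u) \<le> \<Delta>" using that neighbours_subset[OF G] by (intro deg) auto
    moreover have "card ((?N u - {v}) \<inter> R) \<le> card (?N u - {v})"
      using finite_neighbours[OF G] by (intro card_mono) auto
    ultimately have "card ((?N u - {v}) \<inter> R) \<le> \<Delta> - 1" by linarith
    then show ?thesis unfolding \<T>_def using fin(1)
      by (subst n_subsets) (auto intro: binomial_right_mono)
  qed
  have cardB: "\<beta> ^ (k - 1) * card (B T) \<le> card (?P R)" if T: "T \<in> \<T> u" for u T
  proof -
    have TR: "T \<subseteq> R" "card T = k" using T by (auto simp: \<T>_def)
    \<comment> \<open>As \<open>k\<close> is positive, some vertex \<open>t\<close> of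
      \<open>T\<close> can keep its colour; the other \<open>k - 1\<close> are forgotten, which is
      the exponent of \<beta>.\<close>
    then obtain t where t: "t \<in> T" using k by fastforce
    have finT: "finite T" using TR fin(1) finite_subset by blast
    have "card (B T) \<le> card (?P (R - (T - {t})))"
      using fin t TR(1)
      by (intro card_monochromatic_extensions_le[OF G, where v = v]) (auto simp: B_def)
    then have "\<beta> ^ (k - 1) * card (B T) \<le> \<beta> ^ (k - 1) * card (?P (R - (T - {t})))"
      using \<beta> by (intro mult_left_mono) auto
    also have "\<dots> = \<beta> ^ card (T - {t}) * card (?P (R - (T - {t})))"
      using TR t by (simp add: card_Diff_singleton)
    also have "\<dots> \<le> card (?P R)"
      using finT TR \<beta> IH by (intro card_partial_frugal_colourings_diff) auto
    finally show ?thesis .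
  qed

  have "card Y \<le> card (?P ?S \<union> (\<Union>u\<in>?N v. \<Union>T\<in>\<T> u. B T))"
    using cover finP finite_neighbours[OF G] fin\<T> finY by (intro card_mono) (auto simp: B_def)
  also have "\<dots> \<le> card (?P ?S) + card (\<Union>u\<in>?N v. \<Union>T\<in>\<T> u. B T)" by (rule card_Un_le)
  also have "card (\<Union>u\<in>?N v. \<Union>T\<in>\<T> u. B T) \<le> (\<Sum>u\<in>?N v. card (\<Union>T\<in>\<T> u. B T))"
    using finite_neighbours[OF G] by (rule card_UN_le)
  also have "\<dots> \<le> (\<Sum>u\<in>?N v. \<Sum>T\<in>\<T> u. card (B T))"
    using fin\<T> by (intro sum_mono card_UN_le)
  finally have Y_le: "card Y \<le> card (?P ?S) + (\<Sum>u\<in>?N v. \<Sum>T\<in>\<T> u. card (B T))" by simp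
  have "\<beta> ^ (k - 1) * (\<Sum>u\<in>?N v. \<Sum>T\<in>\<T> u. card (B T))
      = (\<Sum>u\<in>?N v. \<Sum>T\<in>\<T> u. \<beta> ^ (k - 1) * card (B T))"
    by (simp add: sum_distrib_left)
  also have "\<dots> \<le> (\<Sum>u\<in>?N v. \<Sum>T\<in>\<T> u. real (card (?P R)))"
    using cardB by (intro sum_mono)
  also have "\<dots> = (\<Sum>u\<in>?N v. card (\<T> u) * card (?P R))" by simp
  also have "\<dots> \<le> (\<Sum>u\<in>?N v. ((\<Delta> - 1) choose k) * card (?P R))"
    using card\<T> by (intro of_nat_mono sum_mono mult_right_mono) auto
  also have "\<dots> = real (card (?N v) * ((\<Delta> - 1) choose k)) * card (?P R)" by simp
  also have "\<dots> \<le> real (\<Delta> * ((\<Delta> - 1) choose k)) * card (?P R)"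
    using deg[of v] vR(1) by (intro mult_right_mono of_nat_mono mult_le_mono1) auto
  finally have bad: "\<beta> ^ (k - 1) * (\<Sum>u\<in>?N v. \<Sum>T\<in>\<T> u. card (B T))
      \<le> real (\<Delta> * ((\<Delta> - 1) choose k)) * card (?P R)" .
  have "card (?P R) * (c - \<Delta>) \<le> card (?P ?S) + (\<Sum>u\<in>?N v. \<Sum>T\<in>\<T> u. card (B T))"
    using cardY Y_le by linarith
  then have "real (c - \<Delta>) * real (card (?P R))
      \<le> real (card (?P ?S)) + real (\<Sum>u\<in>?N v. \<Sum>T\<in>\<T> u. card (B T))"
    by (metis mult.commute of_nat_add of_nat_le_iff of_nat_mult)
  then have "\<beta> ^ (k - 1) * (real (c - \<Delta>) * real (card (?P R)))
      \<le> \<beta> ^ (k - 1) * (real (card (?P ?S)) + real (\<Sum>u\<in>?N v. \<Sum>T\<in>\<T> u. card (B T)))"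
    using \<beta> by (intro mult_left_mono) auto
  then show ?thesis using bad unfolding distrib_left mult.assoc by linarith
qed

section \<open>The strong induction and the resulting lower bound\<close>

lemma card_partial_frugal_colourings_step:
  fixes \<beta> :: real
  assumes G: "pair_graph G" and L: "list_assignment c G L"
    and k: "2 \<le> k" and \<beta>: "0 < \<beta>"
    and \<beta>_pow: "\<beta> ^ k = (real k - 1) * real (max_degree G * ((max_degree G - 1) choose k))"
    and c: "real k * \<beta> / (real k - 1) \<le> real (c - max_degree G)"
    and "S \<subseteq> pverts G" and "v \<in> S"
  shows "\<beta> * card (partial_frugal_colourings k G L (S - {v}))
    \<le> card (partial_frugal_colourings k G L S)"
  using assms(7,8)
proof (induction "card S" arbitrary: S v rule: less_induct)
  case less
  let ?p = "real (card (partial_frugal_colourings k G L (S - {v})))"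
  let ?q = "real (card (partial_frugal_colourings k G L S))"
  let ?D = "real (max_degree G * ((max_degree G - 1) choose k))"
  interpret pair_graph G by fact
  have "finite S" using less.prems finite_subset by fastforce
  have S: "insert v (S - {v}) = S" using less.prems by auto
  \<comment> \<open>Strong induction is required because the sets that arise lie inside
    \<open>S - {v}\<close> and may lack several of its vertices.\<close>
  have IH: "\<beta> * card (partial_frugal_colourings k G L (S' - {w}))
      \<le> card (partial_frugal_colourings k G L S')" if "S' \<subseteq> S - {v}" "w \<in> S'" for S' w
    using that less.prems \<open>finite S\<close> by (intro less.hyps) (auto intro!: psubset_card_mono)
  have "\<beta> ^ (k - 1) * real (c - max_degree G) * ?p
      \<le> \<beta> ^ (k - 1) * card (partial_frugal_colourings k G L (insert v (S - {v}))) + ?D * ?p"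
    using k \<beta> less.prems by (intro card_partial_frugal_colourings_insert[OF G L] IH) auto
  then have ineq: "\<beta> ^ (k - 1) * real (c - max_degree G) * ?p \<le> \<beta> ^ (k - 1) * ?q + ?D * ?p"
    unfolding S .
  have "\<beta> ^ k = \<beta> ^ (k - 1) * \<beta>" using k by (metis mult.commute power_eq_if not_numeral_le_zero)
  \<comment> \<open>This is where the value of \<beta> comes from: bad extensions cost at most
    \<open>\<beta> / (real k - 1)\<close> per colouring of \<open>S - {v}\<close>. Since
    \<open>c\<close> provides \<open>real k * \<beta> / (real k - 1)\<close> proper extensions,
    exactly \<beta> are left over.\<close>
  then have D: "?D = \<beta> ^ (k - 1) * (\<beta> / (real k - 1))"
    using \<beta>_pow k by (simp add: field_simps)
  have "\<beta> ^ (k - 1) * (real k * \<beta> / (real k - 1)) * ?p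
      \<le> \<beta> ^ (k - 1) * real (c - max_degree G) * ?p"
    using c \<beta> by (intro mult_right_mono mult_left_mono) auto
  with ineq have "\<beta> ^ (k - 1) * (real k * \<beta> / (real k - 1) * ?p)
      \<le> \<beta> ^ (k - 1) * (?q + \<beta> / (real k - 1) * ?p)"
    unfolding D by (simp add: algebra_simps)
  then have "real k * \<beta> / (real k - 1) * ?p \<le> ?q + \<beta> / (real k - 1) * ?p"
    using \<beta> by (simp only: mult_le_cancel_left_pos zero_less_power)
  moreover have "real k * \<beta> / (real k - 1) - \<beta> / (real k - 1) = \<beta>"
    unfolding diff_divide_distrib[symmetric] using k by (simp add: field_simps)
  ultimately show ?case by (metis diff_le_eq left_diff_distrib)
qed

lemma card_frugal_list_colourings_ge:
  fixes \<beta> :: real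
  assumes G: "pair_graph G" and L: "list_assignment c G L"
    and "2 \<le> k" and "0 < \<beta>"
    and "\<beta> ^ k = (real k - 1) * real (max_degree G * ((max_degree G - 1) choose k))"
    and "real k * \<beta> / (real k - 1) \<le> real (c - max_degree G)"
  shows "\<beta> ^ card (pverts G) \<le> card (frugal_list_colourings k G L)"
proof -
  interpret pair_graph G by fact
  have "\<beta> ^ card (pverts G) * card (partial_frugal_colourings k G L (pverts G - pverts G))
      \<le> card (partial_frugal_colourings k G L (pverts G))"
    using card_partial_frugal_colourings_step[OF assms] \<open>0 < \<beta>\<close>
    by (intro card_partial_frugal_colourings_diff) auto
  \<comment> \<open>The empty vertex set has exactly one colouring, so the second factor above is
    1.\<close>
  moreover have "partial_frugal_colourings k G L {} = {\<lambda>_. undefined}"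
    by (auto simp: partial_frugal_colourings_def)
  ultimately show ?thesis by (simp add: partial_frugal_colourings_pverts[OF G])
qed

theorem theorem7:
  fixes \<Delta> k c :: nat and \<beta> :: real and G :: "'a pair_pre_digraph"
  assumes "k \<ge> 2" and "\<Delta> > k"
    and "\<beta> = ((real k - 1) * real \<Delta> * real ((\<Delta> - 1) choose k)) powr (1 / real k)"
    and "c = \<Delta> + nat \<lceil>real k * \<beta> / (real k - 1)\<rceil>"
    and "pair_graph G"
    and "max_degree G = \<Delta>"
  shows "(\<exists>\<phi> :: 'a \<Rightarrow> nat. frugal k G \<phi> \<and> uses_at_most c G \<phi>) \<and>
    (\<forall>L :: 'a \<Rightarrow> 'c set. list_assignment c G L \<longrightarrow>
       real (card (frugal_list_colourings k G L)) \<ge> \<beta> ^ card (pverts G))"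
proof -
  let ?b = "(real k - 1) * real \<Delta> * real ((\<Delta> - 1) choose k)"
  \<comment> \<open>From \<open>\<Delta> > k\<close> follows \<open>k \<le> \<Delta> - 1\<close>, so
    the binomial coefficient is positive. Hence \<beta> is a genuine positive \<open>k\<close>-th
    root, and the lower bound on the count is positive.\<close>
  have b: "0 < ?b" using assms(1,2) by simp
  then have \<beta>: "0 < \<beta>" using assms(3) by (metis less_irrefl powr_gt_zero)
  have "\<beta> ^ k = \<beta> powr real k" using \<beta> by (simp add: powr_realpow)
  also have "\<dots> = ?b" using assms(1,3) b by (simp add: powr_powr)
  finally have \<beta>_pow:
      "\<beta> ^ k = (real k - 1) * real (max_degree G * ((max_degree G - 1) choose k))"
    using assms(6) by simp
  have c: "real k * \<beta> / (real k - 1) \<le> real (c - max_degree G)"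
    using assms(4,6) by (simp add: real_nat_ceiling_ge)
  note ge = card_frugal_list_colourings_ge[OF assms(5) _ assms(1) \<beta> \<beta>_pow c]
  \<comment> \<open>Ordinary colouring is the case of identical lists: the positive count yields a
    colouring with values in a set of \<open>c\<close> colours.\<close>
  let ?L = "\<lambda>_ :: 'a. {..<c}"
  have "\<beta> ^ card (pverts G) \<le> card (frugal_list_colourings k G ?L)"
    by (rule ge) (simp add: list_assignment_def)
  then have "frugal_list_colourings k G ?L \<noteq> {}"
    using \<beta> by (metis card.empty less_le_not_le of_nat_0 zero_less_power)
  then obtain \<phi> where \<phi>: "\<phi> \<in> frugal_list_colourings k G ?L" by blast
  then have "\<phi> ` pverts G \<subseteq> {..<c}"
    by (auto simp: frugal_list_colourings_def list_colourings_def PiE_iff)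
  then have "uses_at_most c G \<phi>"
    unfolding uses_at_most_def using card_mono[of "{..<c}" "\<phi> ` pverts G"] by simp
  with \<phi> have "\<exists>\<phi> :: 'a \<Rightarrow> nat. frugal k G \<phi> \<and> uses_at_most c G \<phi>"
    by (auto simp: frugal_list_colourings_def)
  then show ?thesis using ge by blast
qed

end
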